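(* Let $\vartheta$ be a primitive semi-compatible random substitution with topological entropy $s$. Then \[ s\;\leqslant\;\frac{1}{\lambda-1}\bm q_1^\intercal\bm R . \]
   Context: Let $\mathcal A=\{a_1,\dots,a_n\}$ be a finite alphabet, $\mathcal A^+$ the finite non-empty words over $\mathcal A$. A random substitution is a map $\vartheta$ from $\mathcal A$ to finite non-empty subsets of $\mathcal A^+$, extended to words by $\vartheta(u_1\cdots u_m)=\{w_1\cdots w_m: w_k\in\vartheta(u_k)\}$ and to sets of words by unions; powers $\vartheta^m$ are compositions. $|u|_a$ is the number of occurrences of letter $a$ in $u$; $\Phi(u)=(|u|_{a_1},\dots,|u|_{a_n})^\intercal$. $\vartheta$ is semi-compatible if for each $a$ all words in $\vartheta(a)$ have the same $\Phi$. Substitution matrix $M_{ij}=|u|_{a_i}$, $u\in\vartheta(a_j)$; primitive means $M$ primitive, with Perron–Frobenius eigenvalue $\lambda$ and right PF eigenvector $\bm R$ normalised by $\|\bm R\|_1=1$. $\bm q_1=(\log\#\vartheta(a_1),\dots,\log\#\vartheta(a_n))^\intercal$. The language $\mathcal L$ is the set of all subwords of words in $\vartheta^m(a)$, $a\in\mathcal A$, $m\in\mathbb N$; $\mathcal L_\ell$ its words of length $\ell$; the topological entropy is $s=\lim_{\ell\to\infty}\frac1\ell\log\#\mathcal L_\ell$ (the topological entropy of the associated subshift). *)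

theory Defs
  imports "HOL-Analysis.Analysis"
begin

text \<open>Alphabet = a finite type 'a; words = lists; a random substitution maps
each letter to a set of words.\<close>

definition is_random_substitution :: "('a \<Rightarrow> 'a list set) \<Rightarrow> bool" where
  "is_random_substitution \<theta> \<longleftrightarrow>
     (\<forall>a. finite (\<theta> a) \<and> \<theta> a \<noteq> {} \<and> (\<forall>u\<in>\<theta> a. u \<noteq> []))"

fun subst_word :: "('a \<Rightarrow> 'a list set) \<Rightarrow> 'a list \<Rightarrow> 'a list set" where
  "subst_word \<theta> [] = {[]}"
| "subst_word \<theta> (x # xs) = {w @ v | w v. w \<in> \<theta> x \<and> v \<in> subst_word \<theta> xs}"

definition subst_set :: "('a \<Rightarrow> 'a list set) \<Rightarrow> 'a list set \<Rightarrow> 'a list set" where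
  "subst_set \<theta> S = (\<Union>u\<in>S. subst_word \<theta> u)"

text \<open>m-th power of the random substitution applied to a letter.\<close>
definition subst_pow :: "('a \<Rightarrow> 'a list set) \<Rightarrow> nat \<Rightarrow> 'a \<Rightarrow> 'a list set" where
  "subst_pow \<theta> m a = (subst_set \<theta> ^^ m) {[a]}"

definition abelianisation :: "'a::finite list \<Rightarrow> real ^ 'a" where
  "abelianisation u = (\<chi> b. real (count_list u b))"

definition semi_compatible :: "('a::finite \<Rightarrow> 'a list set) \<Rightarrow> bool" where
  "semi_compatible \<theta> \<longleftrightarrow>
     (\<forall>a. \<forall>u\<in>\<theta> a. \<forall>v\<in>\<theta> a. abelianisation u = abelianisation v)"

text \<open>Substitution matrix: entry (i,j) = number of occurrences of i in a word of \<theta>(j).\<close>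
definition subst_matrix :: "('a::finite \<Rightarrow> 'a list set) \<Rightarrow> real ^ 'a ^ 'a" where
  "subst_matrix \<theta> = (\<chi> i j. real (count_list (SOME u. u \<in> \<theta> j) i))"

definition mat_pow :: "real ^ 'n ^ 'n \<Rightarrow> nat \<Rightarrow> real ^ 'n ^ 'n" where
  "mat_pow M k = ((\<lambda>X. X ** M) ^^ k) (mat 1)"

definition primitive_matrix :: "real ^ 'n ^ 'n \<Rightarrow> bool" where
  "primitive_matrix M \<longleftrightarrow> (\<forall>i j. M $ i $ j \<ge> 0) \<and>
     (\<exists>k>0. \<forall>i j. mat_pow M k $ i $ j > 0)"

text \<open>Spectral radius (= Perron--Frobenius eigenvalue for primitive matrices):
  the largest modulus of a complex eigenvalue.\<close>
definition pf_eigenvalue :: "real ^ 'n ^ 'n \<Rightarrow> real" where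
  "pf_eigenvalue M = Max {cmod \<mu> | \<mu>. \<exists>v :: complex ^ 'n. v \<noteq> 0 \<and>
       (\<chi> i j. complex_of_real (M $ i $ j)) *v v = \<mu> *s v}"

text \<open>Right PF eigenvector, normalised to 1-norm 1 (nonnegative entries).\<close>
definition is_right_pf_vector :: "real ^ 'n ^ 'n \<Rightarrow> real ^ 'n \<Rightarrow> bool" where
  "is_right_pf_vector M R \<longleftrightarrow> M *v R = pf_eigenvalue M *s R \<and>
     (\<forall>i. R $ i \<ge> 0) \<and> (\<Sum>i\<in>UNIV. \<bar>R $ i\<bar>) = 1"

definition log_card_vector :: "('a::finite \<Rightarrow> 'a list set) \<Rightarrow> real ^ 'a" where
  "log_card_vector \<theta> = (\<chi> a. ln (real (card (\<theta> a))))"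

text \<open>Language: all (contiguous) subwords of words in \<theta>^m(a).\<close>
definition language :: "('a \<Rightarrow> 'a list set) \<Rightarrow> 'a list set" where
  "language \<theta> = {v. \<exists>a m w p s. w \<in> subst_pow \<theta> m a \<and> w = p @ v @ s}"

definition language_len :: "('a \<Rightarrow> 'a list set) \<Rightarrow> nat \<Rightarrow> 'a list set" where
  "language_len \<theta> l = {v \<in> language \<theta>. length v = l}"

text \<open>Topological entropy s: the limit of (1/l) log #L_l.\<close>
definition has_topological_entropy :: "('a \<Rightarrow> 'a list set) \<Rightarrow> real \<Rightarrow> bool" where
  "has_topological_entropy \<theta> s \<longleftrightarrow>
     ((\<lambda>l. ln (real (card (language_len \<theta> l))) / real l) \<longlonglongrightarrow> s)"

end

theory Submission
  imports Defs
begin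

(* Semi-compatibility gives every word of \<theta>^j(a) the abelianisation M^j e_a, whence
   #\<theta>^p(a) \<le> exp (\<Sum>j<p. q \<bullet> M^j e_a).  By Birkhoff's contraction of the ratios x_i / R_i,
   M^j e_a / \<lambda>^j converges to a positive multiple of R, so for large p this exponent is at most
   (q \<bullet> R / (\<lambda> - 1) + \<epsilon>) |\<theta>^p(a)|.  Every long legal word lies in a short window of some
   \<theta>^p-image of a word; counting the preimages (few, as all |\<theta>^p(a)| are large) and their
   images bounds the entropy by q \<bullet> R / (\<lambda> - 1) + 2\<epsilon>.  If \<lambda> = 1 every legal word has
   length at most 1, so s = 0. *)

section \<open>Powers of a random substitution\<close>

definition conc :: "'a list set \<Rightarrow> 'a list set \<Rightarrow> 'a list set" where
  "conc S T = {w @ v | w v. w \<in> S \<and> v \<in> T}"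

lemma subst_word_Cons_conc: "subst_word \<theta> (x # xs) = conc (\<theta> x) (subst_word \<theta> xs)"
  by (simp add: conc_def)

lemma subst_word_append:
  "subst_word \<theta> (u @ v) = conc (subst_word \<theta> u) (subst_word \<theta> v)"
proof (induction u)
  case Nil
  then show ?case by (auto simp: conc_def)
next
  case (Cons x u)
  show ?case
    unfolding append_Cons subst_word.simps Cons.IH
    by (auto simp: conc_def) (metis append.assoc)+
qed

lemma subst_set_conc: "subst_set \<theta> (conc S T) = conc (subst_set \<theta> S) (subst_set \<theta> T)"
proof (rule set_eqI)
  fix x
  have "x \<in> subst_set \<theta> (conc S T) \<longleftrightarrow> (\<exists>u\<in>S. \<exists>v\<in>T. x \<in> subst_word \<theta> (u @ v))"
    unfolding subst_set_def conc_def by blast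
  also have "\<dots> \<longleftrightarrow> x \<in> conc (subst_set \<theta> S) (subst_set \<theta> T)"
    unfolding subst_word_append subst_set_def conc_def by blast
  finally show "x \<in> subst_set \<theta> (conc S T) \<longleftrightarrow> x \<in> conc (subst_set \<theta> S) (subst_set \<theta> T)" .
qed

lemma funpow_subst_set_conc:
  "(subst_set \<theta> ^^ p) (conc S T) = conc ((subst_set \<theta> ^^ p) S) ((subst_set \<theta> ^^ p) T)"
  by (induction p) (simp_all add: subst_set_conc)

lemma funpow_subst_set_eq_UN: "(subst_set \<theta> ^^ p) S = (\<Union>u\<in>S. (subst_set \<theta> ^^ p) {u})"
proof (induction p arbitrary: S)
  case (Suc p)
  have "(subst_set \<theta> ^^ Suc p) S = subst_set \<theta> (\<Union>u\<in>S. (subst_set \<theta> ^^ p) {u})"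
    by (simp only: funpow.simps o_apply Suc[of S])
  also have "\<dots> = (\<Union>u\<in>S. subst_set \<theta> ((subst_set \<theta> ^^ p) {u}))"
    unfolding subst_set_def by blast
  finally show ?case by simp
qed simp

lemma funpow_subst_set_singleton: "(subst_set \<theta> ^^ p) {u} = subst_word (subst_pow \<theta> p) u"
proof (induction u)
  case Nil
  have "(subst_set \<theta> ^^ p) {[]} = {[]}"
    by (induction p) (simp_all add: subst_set_def)
  then show ?case by simp
next
  case (Cons x u)
  have "{x # u} = conc {[x]} {u}" by (auto simp: conc_def)
  then have "(subst_set \<theta> ^^ p) {x # u} = conc ((subst_set \<theta> ^^ p) {[x]}) ((subst_set \<theta> ^^ p) {u})"
    by (simp add: funpow_subst_set_conc)
  then show ?case using Cons by (simp only: subst_word_Cons_conc subst_pow_def)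
qed

lemma subst_pow_add:
  "subst_pow \<theta> (j + p) a = (\<Union>u\<in>subst_pow \<theta> j a. subst_word (subst_pow \<theta> p) u)"
proof -
  have "subst_pow \<theta> (j + p) a = (subst_set \<theta> ^^ p) (subst_pow \<theta> j a)"
    by (simp add: subst_pow_def add.commute[of j] funpow_add)
  then show ?thesis
    by (simp add: funpow_subst_set_eq_UN[of _ _ "subst_pow \<theta> j a"] funpow_subst_set_singleton)
qed

lemma subst_pow_Suc:
  "subst_pow \<theta> (Suc j) a = (\<Union>u\<in>subst_pow \<theta> j a. subst_word \<theta> u)"
  by (simp add: subst_pow_def subst_set_def)

lemma subst_word_eq_image: "subst_word \<tau> (x # u) = (\<lambda>(w, v). w @ v) ` (\<tau> x \<times> subst_word \<tau> u)"
  by auto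

lemma finite_subst_word: "(\<And>a. finite (\<tau> a)) \<Longrightarrow> finite (subst_word \<tau> u)"
proof (induction u)
  case (Cons x u)
  then show ?case unfolding subst_word_eq_image by simp
qed simp

lemma finite_subst_pow: "(\<And>a. finite (\<theta> a)) \<Longrightarrow> finite (subst_pow \<theta> j a)"
proof (induction j)
  case (Suc j)
  then show ?case unfolding subst_pow_Suc by (simp add: finite_subst_word)
qed (simp add: subst_pow_def)

lemma subst_word_nonempty: "(\<And>a. \<tau> a \<noteq> {}) \<Longrightarrow> subst_word \<tau> u \<noteq> {}"
proof (induction u)
  case (Cons x u)
  then show ?case unfolding subst_word_eq_image by simp
qed simp

lemma subst_pow_nonempty: "(\<And>a. \<theta> a \<noteq> {}) \<Longrightarrow> subst_pow \<theta> j a \<noteq> {}"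
proof (induction j)
  case (Suc j)
  then obtain u where "u \<in> subst_pow \<theta> j a" by blast
  moreover have "subst_word \<theta> u \<noteq> {}" using Suc.prems by (rule subst_word_nonempty)
  ultimately show ?case unfolding subst_pow_Suc by blast
qed (simp add: subst_pow_def)

lemma card_subst_word_le_exp:
  assumes "\<And>a. finite (\<tau> a)" and "\<And>a. real (card (\<tau> a)) \<le> exp (f a)"
  shows "real (card (subst_word \<tau> u)) \<le> exp (sum_list (map f u))"
proof (induction u)
  case (Cons x u)
  have "card (subst_word \<tau> (x # u)) \<le> card (\<tau> x) * card (subst_word \<tau> u)"
    unfolding subst_word_eq_image
    by (metis card_cartesian_product card_image_le assms(1) finite_SigmaI finite_subst_word)
  then have "real (card (subst_word \<tau> (x # u))) \<le> real (card (\<tau> x)) * real (card (subst_word \<tau> u))"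
    by (metis of_nat_le_iff of_nat_mult)
  also have "\<dots> \<le> exp (f x) * exp (sum_list (map f u))"
    using Cons assms(2)[of x] by (intro mult_mono) auto
  finally show ?case by (simp add: exp_add)
qed simp

lemma length_subst_word:
  assumes "\<And>a w. w \<in> \<tau> a \<Longrightarrow> length w = L a"
  shows "x \<in> subst_word \<tau> u \<Longrightarrow> length x = sum_list (map L u)"
  by (induction u arbitrary: x) (auto simp: assms)

section \<open>Counting legal words through windows\<close>

lemma subst_word_suffix_within_offset:
  assumes Mx: "\<And>a w. w \<in> \<tau> a \<Longrightarrow> length w \<le> Mx"
  shows "x \<in> subst_word \<tau> u \<Longrightarrow> x = Pr @ y \<Longrightarrow> y \<noteq> [] \<Longrightarrow>
    \<exists>u' x' d. x' \<in> subst_word \<tau> u' \<and> d < Mx \<and> drop d x' = y"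
proof (induction u arbitrary: x Pr)
  case (Cons a u)
  then obtain b x2 where bx: "x = b @ x2" "b \<in> \<tau> a" "x2 \<in> subst_word \<tau> u" by auto
  show ?case
  proof (cases "length Pr < length b")
    case True
    then show ?thesis
      using Cons.prems bx Mx[OF bx(2)]
      by (intro exI[of _ "a # u"] exI[of _ x] exI[of _ "length Pr"]) auto
  next
    case False
    then obtain Pr' where "x2 = Pr' @ y"
      using Cons.prems bx by (auto simp: append_eq_append_conv2)
    then show ?thesis using Cons.IH bx Cons.prems by blast
  qed
qed simp

lemma subst_word_prefix_within_extension:
  assumes Mx: "\<And>a w. w \<in> \<tau> a \<Longrightarrow> length w \<le> Mx"
  shows "x \<in> subst_word \<tau> u \<Longrightarrow> x = y @ Sf \<Longrightarrow>
    \<exists>u' x' Sf'. x' \<in> subst_word \<tau> u' \<and> x' = y @ Sf' \<and> length x' \<le> length y + Mx"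
proof (induction u arbitrary: x y)
  case Nil then show ?case by (intro exI[of _ "[]"]) auto
next
  case (Cons a u)
  then obtain b x' where bx: "x = b @ x'" "b \<in> \<tau> a" "x' \<in> subst_word \<tau> u" by auto
  show ?case
  proof (cases "length y \<le> length b")
    case True
    then have "b = y @ drop (length y) b"
      using Cons.prems bx by (metis append_eq_append_conv_if append_take_drop_id)
    moreover have "b \<in> subst_word \<tau> [a]" using bx by auto
    moreover have "length b \<le> length y + Mx" using Mx bx by fastforce
    ultimately show ?thesis by blast
  next
    case False
    then obtain y' where y': "y = b @ y'" "x' = y' @ Sf"
      using Cons.prems bx by (auto simp: append_eq_append_conv2)
    then obtain u2 x2 Sf' where "x2 \<in> subst_word \<tau> u2" "x2 = y' @ Sf'" "length x2 \<le> length y' + Mx"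
      using Cons.IH bx by blast
    then show ?thesis
      using y' bx by (intro exI[of _ "a # u2"] exI[of _ "b @ x2"] exI[of _ Sf']) auto
  qed
qed

definition windows :: "('a \<Rightarrow> 'a list set) \<Rightarrow> nat \<Rightarrow> nat \<Rightarrow> nat \<Rightarrow> 'a list set" where
  "windows \<tau> Mx N l = {take l (drop d x) | u x d. x \<in> subst_word \<tau> u \<and> d < Mx \<and> length x \<le> N}"

lemma factor_subst_word_in_windows:
  assumes Mx: "\<And>a w. w \<in> \<tau> a \<Longrightarrow> length w \<le> Mx"
    and x: "x \<in> subst_word \<tau> u" "x = Pr @ v @ Sf" and v: "v \<noteq> []"
  shows "v \<in> windows \<tau> Mx (length v + 2 * Mx) (length v)"
proof -
  have "\<exists>u1 x1 d. x1 \<in> subst_word \<tau> u1 \<and> d < Mx \<and> drop d x1 = v @ Sf"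
    by (rule subst_word_suffix_within_offset[where Pr=Pr]) (use Mx x v in auto)
  then obtain u1 x1 d where x1: "x1 \<in> subst_word \<tau> u1" "d < Mx" "drop d x1 = v @ Sf"
    by blast
  have "d \<le> length x1" using x1(3) v by (metis drop_all le_cases list.size(3) Nil_is_append_conv)
  then have d: "length (take d x1) = d" by simp
  have x1_split: "x1 = (take d x1 @ v) @ Sf" using x1(3) by (metis append.assoc append_take_drop_id)
  have "\<exists>u2 x2 Sf'. x2 \<in> subst_word \<tau> u2 \<and> x2 = (take d x1 @ v) @ Sf'
      \<and> length x2 \<le> length (take d x1 @ v) + Mx"
    by (rule subst_word_prefix_within_extension[where Sf=Sf]) (use Mx x1(1) x1_split in auto)
  then obtain u2 x2 Sf' where x2: "x2 \<in> subst_word \<tau> u2" "x2 = (take d x1 @ v) @ Sf'"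
     "length x2 \<le> length (take d x1 @ v) + Mx"
    by blast
  have "v = take (length v) (drop d x2)" and "length x2 \<le> length v + 2 * Mx"
    using x2(2,3) d x1(2) by simp_all
  then show ?thesis unfolding windows_def using x1(2) x2(1) by blast
qed

lemma card_lists_length_le_exp:
  "real (card {u :: 'a::finite list. length u \<le> K}) \<le> exp (real K * (1 + ln CARD('a)))"
proof -
  have "card {u :: 'a list. length u \<le> K} = (\<Sum>i\<le>K. CARD('a) ^ i)"
    using card_lists_length_le[of "UNIV :: 'a set" K] by simp
  also have "\<dots> \<le> (\<Sum>i\<le>K. CARD('a) ^ K)"
    by (intro sum_mono power_increasing) (simp_all add: Suc_leI)
  also have "\<dots> = Suc K * CARD('a) ^ K" by simp
  finally have "real (card {u :: 'a list. length u \<le> K}) \<le> real (Suc K * CARD('a) ^ K)"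
    by (simp only: of_nat_le_iff)
  also have "\<dots> = (real K + 1) * real CARD('a) ^ K" by (simp add: algebra_simps)
  also have "\<dots> \<le> exp (real K) * exp (real K * ln CARD('a))"
    using exp_ge_add_one_self[of "real K"]
    by (intro mult_mono) (simp_all add: exp_of_nat_mult add.commute)
  finally show ?thesis by (simp add: exp_add[symmetric] algebra_simps)
qed

lemma card_subst_word_length_le:
  assumes fin: "\<And>a. finite (\<tau> a)" and len: "\<And>a w. w \<in> \<tau> a \<Longrightarrow> length w = L a"
    and C: "0 \<le> C" and card: "\<And>a. real (card (\<tau> a)) \<le> exp (C * real (L a))"
  shows "real (card {x \<in> subst_word \<tau> u. length x \<le> N}) \<le> exp (C * real N)"
proof (cases "{x \<in> subst_word \<tau> u. length x \<le> N} = {}")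
  case False
  then obtain x where x: "x \<in> subst_word \<tau> u" "length x \<le> N" by auto
  have "real (card {x \<in> subst_word \<tau> u. length x \<le> N}) \<le> real (card (subst_word \<tau> u))"
    using finite_subst_word[OF fin] by (simp add: card_mono)
  also have "\<dots> \<le> exp (sum_list (map (\<lambda>a. C * real (L a)) u))"
    by (rule card_subst_word_le_exp[OF fin card])
  also have "sum_list (map (\<lambda>a. C * real (L a)) u) = C * real (sum_list (map L u))"
    by (induction u) (simp_all add: algebra_simps)
  also have "sum_list (map L u) = length x"
    using length_subst_word[OF len x(1)] by simp
  also have "exp (C * real (length x)) \<le> exp (C * real N)" using x(2) C by (simp add: mult_left_mono)
  finally show ?thesis .
next
  case True
  then show ?thesis by (subst True) simp
qed

lemma length_preimage_le:
  assumes len: "\<And>a w. w \<in> \<tau> a \<Longrightarrow> length w = L a"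
    and m: "\<And>a. m \<le> L a" and x: "x \<in> subst_word \<tau> u"
  shows "m * length u \<le> length x"
proof -
  have "m * length u \<le> sum_list (map L u)"
    using m by (induction u) (auto simp: add_mono)
  then show ?thesis using length_subst_word[OF len x] by simp
qed

(* A window is fixed by a preimage of at most N div m letters, one of its at most exp (C N)
   images of length \<le> N, and an offset. *)
lemma card_windows_le:
  fixes \<tau> :: "'a::finite \<Rightarrow> 'a list set" and L :: "'a \<Rightarrow> nat"
  assumes fin: "\<And>a. finite (\<tau> a)" and len: "\<And>a w. w \<in> \<tau> a \<Longrightarrow> length w = L a"
    and m: "\<And>a. m \<le> L a" "1 \<le> m" and C: "0 \<le> C"
    and card: "\<And>a. real (card (\<tau> a)) \<le> exp (C * real (L a))"
  shows "real (card (windows \<tau> Mx N l)) \<le> real Mx * exp (real N * (C + (1 + ln CARD('a)) / m))"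
proof -
  define K where "K = N div m"
  define U where "U = {u :: 'a list. length u \<le> K}"
  define X where "X u = {x \<in> subst_word \<tau> u. length x \<le> N}" for u
  define T where "T = Sigma U (\<lambda>u. X u \<times> {..<Mx})"
  have fin_U: "finite U" unfolding U_def using finite_lists_length_le[of "UNIV :: 'a set" K] by simp
  have fin_T: "finite T" unfolding T_def X_def using fin_U finite_subst_word[OF fin] by auto
  have "windows \<tau> Mx N l \<subseteq> (\<lambda>(u, x, d). take l (drop d x)) ` T"
  proof
    fix v assume "v \<in> windows \<tau> Mx N l"
    then obtain u x d where v: "v = take l (drop d x)" "x \<in> subst_word \<tau> u" "d < Mx" "length x \<le> N"
      unfolding windows_def by blast
    have "length u * m \<le> N" using length_preimage_le[where L=L, OF len m(1) v(2)] v(4) by (simp add: mult.commute)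
    then have "length u \<le> K" unfolding K_def using m(2) by (simp add: less_eq_div_iff_mult_less_eq)
    then show "v \<in> (\<lambda>(u, x, d). take l (drop d x)) ` T"
      unfolding T_def U_def X_def using v by force
  qed
  then have "real (card (windows \<tau> Mx N l)) \<le> real (card T)"
    using fin_T card_image_le[OF fin_T] by (meson card_mono finite_imageI of_nat_le_iff order_trans)
  also have "\<dots> = (\<Sum>u\<in>U. real (card (X u)) * real Mx)"
    unfolding T_def X_def using fin_U finite_subst_word[OF fin] by (simp add: card_cartesian_product)
  also have "\<dots> \<le> real (card U) * exp (C * real N) * real Mx"
    using sum_mono[of U "\<lambda>u. real (card (X u)) * real Mx" "\<lambda>_. exp (C * real N) * real Mx"]
      card_subst_word_length_le[OF fin len C card] by (simp add: X_def mult_right_mono)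
  also have "\<dots> \<le> exp (real K * (1 + ln CARD('a))) * exp (C * real N) * real Mx"
    unfolding U_def by (intro mult_right_mono card_lists_length_le_exp) simp_all
  also have "\<dots> \<le> exp (real N / real m * (1 + ln CARD('a))) * exp (C * real N) * real Mx"
  proof (intro mult_right_mono)
    have "real K \<le> real N / real m"
      using m(2) div_times_less_eq_dividend[of N m] by (simp add: K_def le_divide_eq flip: of_nat_mult)
    then have "real K * (1 + ln CARD('a)) \<le> real N / real m * (1 + ln CARD('a))"
      by (rule mult_right_mono) simp
    then show "exp (real K * (1 + ln CARD('a))) \<le> exp (real N / real m * (1 + ln CARD('a)))"
      by simp
  qed simp_all
  also have "\<dots> = real Mx * exp (real N * (C + (1 + ln CARD('a)) / m))"
    by (simp add: exp_add[symmetric] algebra_simps add_divide_distrib)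
  finally show ?thesis .
qed

lemma ln_card_le_of_card_le_exp:
  assumes "real (card A) \<le> exp y" and "0 \<le> y"
  shows "ln (real (card A)) \<le> y"
proof (cases "card A = 0")
  case False
  then have "ln (real (card A)) \<le> ln (exp y)" using assms(1) by (subst ln_le_cancel_iff) simp_all
  then show ?thesis by simp
qed (simp add: assms(2))

lemma le_of_tendsto_divide_affine_bound:
  fixes f :: "nat \<Rightarrow> real"
  assumes lim: "(\<lambda>l. f l / real l) \<longlonglongrightarrow> s"
    and bound: "\<forall>\<^sub>F l in sequentially. f l \<le> A + G * real l"
  shows "s \<le> G"
proof (rule tendsto_le[OF sequentially_bot])
  show "(\<lambda>l. A / real l + G) \<longlonglongrightarrow> G"
    using tendsto_add[OF lim_const_over_n[of A] tendsto_const[of G]] by simp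
  show "\<forall>\<^sub>F l in sequentially. f l / real l \<le> A / real l + G"
    using bound eventually_gt_at_top[of 0]
  proof eventually_elim
    case (elim l)
    then have "f l / real l \<le> (A + G * real l) / real l" by (intro divide_right_mono) auto
    then show ?case using elim(2) by (simp add: add_divide_distrib)
  qed
qed (rule lim)

lemma entropy_le_of_covering_substitution:
  fixes \<theta> \<tau> :: "'a::finite \<Rightarrow> 'a list set" and L :: "'a \<Rightarrow> nat"
  assumes fin: "\<And>a. finite (\<tau> a)" and len: "\<And>a w. w \<in> \<tau> a \<Longrightarrow> length w = L a"
    and m: "\<And>a. m \<le> L a" "1 \<le> m" and C: "0 \<le> C"
    and card: "\<And>a. real (card (\<tau> a)) \<le> exp (C * real (L a))"
    and cover: "\<forall>\<^sub>F l in sequentially. \<forall>v\<in>language_len \<theta> l.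
      \<exists>u w Pr Sf. w \<in> subst_word \<tau> u \<and> w = Pr @ v @ Sf"
    and entropy: "has_topological_entropy \<theta> s"
  shows "s \<le> C + (1 + ln CARD('a)) / m"
proof (rule le_of_tendsto_divide_affine_bound)
  define Mx where "Mx = Max (range L)"
  define G where "G = C + (1 + ln CARD('a)) / m"
  have L_le: "L a \<le> Mx" for a by (simp add: Mx_def)
  have Mx: "length w \<le> Mx" if "w \<in> \<tau> a" for w a
    using len[OF that] L_le by simp
  have Mx_pos: "1 \<le> Mx" using m(1)[of undefined] m(2) L_le[of undefined] by simp
  have G_nonneg: "0 \<le> G" using C by (simp add: G_def add_nonneg_nonneg)
  show "(\<lambda>l. ln (real (card (language_len \<theta> l))) / real l) \<longlonglongrightarrow> s"
    using entropy by (simp add: has_topological_entropy_def)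
  show "\<forall>\<^sub>F l in sequentially.
    ln (real (card (language_len \<theta> l))) \<le> (ln Mx + 2 * Mx * G) + G * real l"
    using cover eventually_gt_at_top[of 0]
  proof eventually_elim
    case (elim l)
    have "language_len \<theta> l \<subseteq> windows \<tau> Mx (l + 2 * Mx) l"
    proof
      fix v assume v: "v \<in> language_len \<theta> l"
      then have v_len: "v \<noteq> []" "length v = l" using elim(2) by (auto simp: language_len_def)
      obtain u w Pr Sf where "w \<in> subst_word \<tau> u" "w = Pr @ v @ Sf" using elim(1) v by blast
      then have "v \<in> windows \<tau> Mx (length v + 2 * Mx) (length v)"
        by (intro factor_subst_word_in_windows[where \<tau>=\<tau>]) (use Mx v_len in auto)
      then show "v \<in> windows \<tau> Mx (l + 2 * Mx) l" using v_len by simp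
    qed
    moreover have "finite (windows \<tau> Mx (l + 2 * Mx) l)"
      by (rule finite_subset[OF _ finite_lists_length_le[of UNIV l]]) (auto simp: windows_def)
    ultimately have "real (card (language_len \<theta> l)) \<le> real (card (windows \<tau> Mx (l + 2 * Mx) l))"
      by (simp add: card_mono)
    also have "\<dots> \<le> real Mx * exp (real (l + 2 * Mx) * G)"
      unfolding G_def by (rule card_windows_le[OF fin len m C card])
    also have "\<dots> = exp (ln Mx + 2 * Mx * G + G * real l)"
      using Mx_pos by (simp add: exp_add algebra_simps)
    finally show ?case
      using Mx_pos G_nonneg by (intro ln_card_le_of_card_le_exp) simp_all
  qed
qed

lemma eventually_language_factor_of_subst_pow:
  fixes \<theta> :: "'a::finite \<Rightarrow> 'a list set"
  assumes fin: "\<And>a. finite (\<theta> a)"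
  shows "\<forall>\<^sub>F l in sequentially. \<forall>v\<in>language_len \<theta> l.
    \<exists>u w Pr Sf. w \<in> subst_word (subst_pow \<theta> p) u \<and> w = Pr @ v @ Sf"
proof -
  have "finite (\<Union>j<p. \<Union>a. length ` subst_pow \<theta> j a)"
    by (simp add: finite_subst_pow fin)
  then obtain H where "\<forall>n\<in>(\<Union>j<p. \<Union>a. length ` subst_pow \<theta> j a). n \<le> H"
    unfolding finite_nat_set_iff_bounded_le ..
  then have H: "length w \<le> H" if "j < p" "w \<in> subst_pow \<theta> j a" for j a w
    using that by blast
  show ?thesis
    using eventually_gt_at_top[of H]
  proof eventually_elim
    case (elim l)
    show ?case
    proof
      fix v assume "v \<in> language_len \<theta> l"
      then obtain a j w Pr Sf where v: "length v = l" "w \<in> subst_pow \<theta> j a" "w = Pr @ v @ Sf"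
        unfolding language_len_def language_def by auto
      have "\<not> j < p"
      proof
        assume "j < p"
        then have "length w \<le> H" using v(2) by (rule H)
        then show False using v(1,3) elim by simp
      qed
      then have "w \<in> subst_pow \<theta> ((j - p) + p) a" using v(2) by simp
      then obtain u where "w \<in> subst_word (subst_pow \<theta> p) u" unfolding subst_pow_add by blast
      then show "\<exists>u w Pr Sf. w \<in> subst_word (subst_pow \<theta> p) u \<and> w = Pr @ v @ Sf"
        using v(3) by blast
    qed
  qed
qed

section \<open>Abelianisation\<close>

lemma abelianisation_append: "abelianisation (u @ v) = abelianisation u + abelianisation v"
  by (simp add: abelianisation_def vec_eq_iff)

lemma abelianisation_Nil: "abelianisation [] = 0"
  by (simp add: abelianisation_def vec_eq_iff)

lemma length_eq_sum_abelianisation: "real (length w) = (\<Sum>i\<in>UNIV. abelianisation w $ i)"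
  using sum_count_set[of w UNIV] by (simp add: abelianisation_def flip: of_nat_sum)

lemma matrix_vector_mult_abelianisation_singleton:
  "A *v abelianisation [x] = (\<chi> i. A $ i $ x)"
  by (simp add: vec_eq_iff matrix_vector_mult_def abelianisation_def if_distrib cong: if_cong)

lemma inner_abelianisation: "q \<bullet> abelianisation u = sum_list (map (($) q) u)"
proof (induction u)
  case (Cons x u)
  have "q \<bullet> abelianisation [x] = q $ x"
    by (simp add: inner_vec_def abelianisation_def if_distrib cong: if_cong)
  then show ?case
    using Cons abelianisation_append[of "[x]" u] by (simp add: inner_add_right)
qed (simp add: abelianisation_Nil)

lemma sum_matrix_vector_mult:
  "(\<Sum>i\<in>UNIV. (A *v x) $ i) = (\<Sum>j\<in>UNIV. (\<Sum>i\<in>UNIV. A $ i $ j) * x $ j)"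
  unfolding matrix_vector_mult_def by (simp add: sum_distrib_right) (rule sum.swap)

section \<open>Perron--Frobenius asymptotics\<close>

(* Tannery's theorem, applied to the reversed sums \<Sum>k<p. a (p - Suc k) * t ^ Suc k. *)
lemma tendsto_sum_mult_power_diff:
  fixes a :: "nat \<Rightarrow> real"
  assumes a: "a \<longlonglongrightarrow> A" and t: "0 \<le> t" "t < 1"
  shows "(\<lambda>p. \<Sum>j<p. a j * t ^ (p - j)) \<longlonglongrightarrow> A * (t / (1 - t))"
proof -
  define f where "f k p = (if k < p then a (p - Suc k) * t ^ Suc k else 0)" for k p
  obtain K where "K > 0" and K: "\<And>j. norm (a j) \<le> K"
    using convergent_imp_Bseq[OF convergentI[OF a]] by (auto simp: Bseq_def)
  have sum_eq: "(\<Sum>j<p. a j * t ^ (p - j)) = (\<Sum>k. f k p)" for p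
  proof -
    have "(\<Sum>k. f k p) = (\<Sum>k<p. a (p - Suc k) * t ^ Suc k)"
      by (subst suminf_finite[of "{..<p}"]) (auto simp: f_def)
    also have "\<dots> = (\<Sum>j<p. a j * t ^ (p - j))"
      by (subst sum.nat_diff_reindex[symmetric]) (simp add: Suc_diff_Suc)
    finally show ?thesis ..
  qed
  have "((\<lambda>p. \<Sum>k. f k p) \<longlongrightarrow> (\<Sum>k. A * t ^ Suc k)) sequentially"
  proof (rule tannerys_theorem[THEN conjunct2, THEN conjunct2])
    fix k
    have "(\<lambda>p. a (p - Suc k) * t ^ Suc k) \<longlonglongrightarrow> A * t ^ Suc k"
      by (intro tendsto_mult_right filterlim_compose[OF a filterlim_minus_const_nat_at_top])
    moreover have "\<forall>\<^sub>F p in sequentially. a (p - Suc k) * t ^ Suc k = f k p"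
      using eventually_gt_at_top[of k] by eventually_elim (simp add: f_def)
    ultimately show "(\<lambda>p. f k p) \<longlonglongrightarrow> A * t ^ Suc k" by (rule Lim_transform_eventually)
  next
    show "\<forall>\<^sub>F (k, p) in at_top \<times>\<^sub>F sequentially. norm (f k p) \<le> K * t ^ Suc k"
      using K t \<open>K > 0\<close> by (intro always_eventually) (auto simp: f_def abs_mult intro: mult_right_mono)
    show "summable (\<lambda>k. K * t ^ Suc k)"
      using t by (intro summable_mult) simp
  qed simp
  moreover have "(\<Sum>k. A * t ^ Suc k) = A * (t / (1 - t))"
    using t by (simp add: suminf_mult suminf_geometric[of t] field_simps)
  ultimately show ?thesis by (simp add: sum_eq)
qed

definition max_ratio :: "real^'n \<Rightarrow> real^'n::finite \<Rightarrow> real" where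
  "max_ratio R x = Max (range (\<lambda>i. x$i / R$i))"

definition min_ratio :: "real^'n \<Rightarrow> real^'n::finite \<Rightarrow> real" where
  "min_ratio R x = Min (range (\<lambda>i. x$i / R$i))"

context
  fixes R :: "real^'n::finite"
  assumes R_pos: "\<And>i. R$i > 0"
begin

lemma le_max_ratio: "x$i \<le> max_ratio R x * R$i"
proof -
  have "x$i / R$i \<le> max_ratio R x" unfolding max_ratio_def by (rule Max_ge) auto
  then show ?thesis using R_pos[of i] by (simp add: divide_le_eq)
qed

lemma min_ratio_le: "min_ratio R x * R$i \<le> x$i"
proof -
  have "min_ratio R x \<le> x$i / R$i" unfolding min_ratio_def by (rule Min_le) auto
  then show ?thesis using R_pos[of i] by (simp add: le_divide_eq)
qed

lemma max_ratio_le: "(\<And>i. x$i \<le> c * R$i) \<Longrightarrow> max_ratio R x \<le> c"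
  unfolding max_ratio_def using R_pos by (auto simp: divide_le_eq)

lemma min_ratio_ge: "(\<And>i. c * R$i \<le> x$i) \<Longrightarrow> c \<le> min_ratio R x"
  unfolding min_ratio_def using R_pos by (auto simp: le_divide_eq)

lemma min_ratio_le_max_ratio: "min_ratio R x \<le> max_ratio R x"
  using min_ratio_le[of x] le_max_ratio[of x] R_pos
  by (meson mult_le_cancel_right_pos order_trans)

lemma min_ratio_pos: "(\<And>i. x$i > 0) \<Longrightarrow> min_ratio R x > 0"
  unfolding min_ratio_def using R_pos by simp

lemma min_ratio_le_sum: "(\<Sum>i\<in>UNIV. R$i) = 1 \<Longrightarrow> min_ratio R x \<le> (\<Sum>i\<in>UNIV. x$i)"
  using sum_mono[of UNIV "\<lambda>i. min_ratio R x * R$i", OF min_ratio_le]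
  by (simp add: sum_distrib_left[symmetric])

lemma inner_le_max_ratio:
  "(\<And>i. q$i \<ge> 0) \<Longrightarrow> q \<bullet> x \<le> max_ratio R x * (q \<bullet> R)"
  unfolding inner_vec_def sum_distrib_left
  by (rule sum_mono) (simp add: mult.left_commute mult_left_mono le_max_ratio)

context
  fixes A :: "real^'n^'n" and \<mu> :: real
  assumes A_nonneg: "\<And>i j. A$i$j \<ge> 0" and A_eigen: "A *v R = \<mu> *s R"
begin

lemma max_ratio_mult_le: "max_ratio R (A *v x) \<le> \<mu> * max_ratio R x"
proof (rule max_ratio_le)
  fix i
  have "(A *v x)$i \<le> (\<Sum>j\<in>UNIV. A$i$j * (max_ratio R x * R$j))"
    unfolding matrix_vector_mult_def
    by (simp add: sum_mono mult_left_mono A_nonneg le_max_ratio)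
  also have "\<dots> = max_ratio R x * (A *v R)$i"
    by (simp add: matrix_vector_mult_def sum_distrib_left algebra_simps)
  finally show "(A *v x)$i \<le> \<mu> * max_ratio R x * R$i" using A_eigen by (simp add: mult_ac)
qed

lemma min_ratio_mult_ge: "\<mu> * min_ratio R x \<le> min_ratio R (A *v x)"
proof (rule min_ratio_ge)
  fix i
  have "\<mu> * min_ratio R x * R$i = min_ratio R x * (A *v R)$i" using A_eigen by simp
  also have "\<dots> = (\<Sum>j\<in>UNIV. A$i$j * (min_ratio R x * R$j))"
    by (simp add: matrix_vector_mult_def sum_distrib_left algebra_simps)
  also have "\<dots> \<le> (A *v x)$i"
    unfolding matrix_vector_mult_def
    by (simp add: sum_mono mult_left_mono A_nonneg min_ratio_le)
  finally show "\<mu> * min_ratio R x * R$i \<le> (A *v x)$i" .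
qed

end

context
  fixes P :: "real^'n^'n" and \<mu> \<beta> :: real
  assumes R_sum: "(\<Sum>i\<in>UNIV. R$i) = 1"
    and P_eigen: "P *v R = \<mu> *s R" and P_ge: "\<And>i j. \<beta> * R$i \<le> P$i$j"
begin

lemma min_ratio_mult_contract:
  "\<mu> * min_ratio R x + \<beta> * ((\<Sum>j\<in>UNIV. x$j) - min_ratio R x) \<le> min_ratio R (P *v x)"
proof (rule min_ratio_ge)
  fix i
  let ?m = "min_ratio R x"
  have "\<beta> * ((\<Sum>j\<in>UNIV. x$j) - ?m) * R$i = \<beta> * R$i * ((\<Sum>j\<in>UNIV. x$j) - ?m * (\<Sum>j\<in>UNIV. R$j))"
    using R_sum by simp
  also have "\<dots> = (\<Sum>j\<in>UNIV. \<beta> * R$i * (x$j - ?m * R$j))"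
    by (simp add: sum_subtractf flip: sum_distrib_left)
  also have "\<dots> \<le> (\<Sum>j\<in>UNIV. P$i$j * (x$j - ?m * R$j))"
    by (intro sum_mono mult_right_mono P_ge) (simp add: min_ratio_le)
  also have "\<dots> = (P *v x)$i - ?m * (P *v R)$i"
    by (simp add: matrix_vector_mult_def sum_subtractf sum_distrib_left algebra_simps)
  finally show "(\<mu> * ?m + \<beta> * ((\<Sum>j\<in>UNIV. x$j) - ?m)) * R$i \<le> (P *v x)$i"
    using P_eigen by (simp add: algebra_simps)
qed

lemma max_ratio_mult_contract:
  "max_ratio R (P *v x) \<le> \<mu> * max_ratio R x - \<beta> * (max_ratio R x - (\<Sum>j\<in>UNIV. x$j))"
proof (rule max_ratio_le)
  fix i
  let ?M = "max_ratio R x"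
  have "\<beta> * (?M - (\<Sum>j\<in>UNIV. x$j)) * R$i = \<beta> * R$i * (?M * (\<Sum>j\<in>UNIV. R$j) - (\<Sum>j\<in>UNIV. x$j))"
    using R_sum by simp
  also have "\<dots> = (\<Sum>j\<in>UNIV. \<beta> * R$i * (?M * R$j - x$j))"
    by (simp add: sum_subtractf flip: sum_distrib_left)
  also have "\<dots> \<le> (\<Sum>j\<in>UNIV. P$i$j * (?M * R$j - x$j))"
    by (intro sum_mono mult_right_mono P_ge) (simp add: le_max_ratio)
  also have "\<dots> = ?M * (P *v R)$i - (P *v x)$i"
    by (simp add: matrix_vector_mult_def sum_subtractf sum_distrib_left algebra_simps)
  finally show "(P *v x)$i \<le> (\<mu> * ?M - \<beta> * (?M - (\<Sum>j\<in>UNIV. x$j))) * R$i"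
    using P_eigen by (simp add: algebra_simps)
qed

lemma ratio_gap_mult_contract:
  "max_ratio R (P *v x) - min_ratio R (P *v x) \<le> (\<mu> - \<beta>) * (max_ratio R x - min_ratio R x)"
  using min_ratio_mult_contract[of x] max_ratio_mult_contract[of x] by (simp add: algebra_simps)

end

end

lemma eigenvector_pos_of_pos_matrix:
  fixes P :: "real^'n::finite^'n"
  assumes P_pos: "\<And>i j. P$i$j > 0" and eigen: "P *v R = \<mu> *s R"
    and R_nonneg: "\<And>i. R$i \<ge> 0" and R_ne: "R \<noteq> 0"
  shows "R$i > 0"
proof -
  obtain j where j: "R$j > 0"
    using R_ne R_nonneg by (metis less_eq_real_def vec_eq_iff zero_index)
  have "0 < P$i$j * R$j" using P_pos j by simp
  also have "\<dots> \<le> (\<Sum>l\<in>UNIV. P$i$l * R$l)"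
    by (rule member_le_sum) (auto intro: mult_nonneg_nonneg less_imp_le P_pos R_nonneg)
  also have "\<dots> = \<mu> * R$i" using eigen by (simp add: matrix_vector_mult_def vec_eq_iff)
  finally show ?thesis using R_nonneg[of i] by (cases "R$i = 0") auto
qed

lemma mat_pow_mult_vec: "mat_pow M j *v x = ((*v) M ^^ j) x"
proof (induction j arbitrary: x)
  case 0 then show ?case by (simp add: mat_pow_def)
next
  case (Suc j)
  have "mat_pow M (Suc j) *v x = mat_pow M j *v (M *v x)"
    by (simp add: mat_pow_def matrix_vector_mul_assoc)
  then show ?case by (simp only: Suc funpow_Suc_right o_apply)
qed

lemma mat_pow_eigen:
  assumes "M *v R = \<rho> *s R" shows "mat_pow M k *v R = \<rho> ^ k *s R"
proof -
  have "((*v) M ^^ j) R = \<rho> ^ j *s R" for j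
    by (induction j) (simp_all add: assms matrix_vector_mult_scaleR scalar_mult_eq_scaleR)
  then show ?thesis by (simp add: mat_pow_mult_vec)
qed

locale primitive_orbit =
  fixes M :: "real^'n::finite^'n" and R :: "real^'n" and \<rho> :: real and k :: nat
    and x\<^sub>0 :: "real^'n"
  assumes M_nonneg: "\<And>i j. M$i$j \<ge> 0" and eigen: "M *v R = \<rho> *s R"
    and R_nonneg: "\<And>i. R$i \<ge> 0" and R_sum: "(\<Sum>i\<in>UNIV. R$i) = 1"
    and power_pos: "\<And>i j. mat_pow M k $ i $ j > 0"
    and eigenvalue_gt_1: "\<rho> > 1"
    and start_pos: "\<And>i. (mat_pow M k *v x\<^sub>0) $ i > 0"
begin

abbreviation "P \<equiv> mat_pow M k"

abbreviation orbit :: "nat \<Rightarrow> real^'n" where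
  "orbit j \<equiv> ((*v) M ^^ j) x\<^sub>0"

definition lower :: "nat \<Rightarrow> real" where
  "lower j = min_ratio R (orbit j) / \<rho> ^ j"

definition upper :: "nat \<Rightarrow> real" where
  "upper j = max_ratio R (orbit j) / \<rho> ^ j"

lemma eigenvalue_pos: "\<rho> > 0"
  using eigenvalue_gt_1 by simp

lemma power_eigen: "P *v R = \<rho> ^ k *s R"
  by (rule mat_pow_eigen[OF eigen])

lemma R_pos: "R$i > 0"
proof (rule eigenvector_pos_of_pos_matrix[OF power_pos power_eigen R_nonneg])
  show "R \<noteq> 0" using R_sum by auto
qed

lemma orbit_Suc: "orbit (Suc j) = M *v orbit j"
  by simp

lemma orbit_add_power: "orbit (j + k) = P *v orbit j"
  by (simp add: mat_pow_mult_vec funpow_add add.commute[of j])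

lemma incseq_lower: "incseq lower"
proof (rule incseq_SucI)
  fix j
  have "\<rho> * min_ratio R (orbit j) \<le> min_ratio R (orbit (Suc j))"
    unfolding orbit_Suc by (rule min_ratio_mult_ge[OF R_pos M_nonneg eigen])
  then show "lower j \<le> lower (Suc j)"
    using eigenvalue_pos by (simp add: lower_def field_simps)
qed

lemma decseq_upper: "decseq upper"
proof (rule decseq_SucI)
  fix j
  have "max_ratio R (orbit (Suc j)) \<le> \<rho> * max_ratio R (orbit j)"
    unfolding orbit_Suc by (rule max_ratio_mult_le[OF R_pos M_nonneg eigen])
  then show "upper (Suc j) \<le> upper j"
    using eigenvalue_pos by (simp add: upper_def field_simps)
qed

lemma lower_le_upper: "lower j \<le> upper j"
  using min_ratio_le_max_ratio[OF R_pos] eigenvalue_pos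
  by (simp add: lower_def upper_def divide_right_mono)

lemma contraction_constant:
  obtains \<beta> where "0 < \<beta>" "\<beta> \<le> \<rho> ^ k" "\<And>i j. \<beta> * R$i \<le> P$i$j"
proof
  define \<beta> where "\<beta> = Min (range (\<lambda>(i, j). P$i$j / R$i))"
  show "\<beta> > 0"
    unfolding \<beta>_def using power_pos R_pos by simp
  show le: "\<beta> * R$i \<le> P$i$j" for i j
  proof -
    have "\<beta> \<le> P$i$j / R$i" unfolding \<beta>_def by (rule Min_le) auto
    then show ?thesis using R_pos[of i] by (simp add: le_divide_eq)
  qed
  obtain i :: 'n where True by blast
  have "\<beta> * R$i = (\<Sum>j\<in>UNIV. \<beta> * R$i * R$j)"
    using R_sum by (simp flip: sum_distrib_left)
  also have "\<dots> \<le> (\<Sum>j\<in>UNIV. P$i$j * R$j)"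
    by (intro sum_mono mult_right_mono le R_nonneg)
  also have "\<dots> = \<rho> ^ k * R$i"
    using power_eigen by (simp add: matrix_vector_mult_def vec_eq_iff)
  finally show "\<beta> \<le> \<rho> ^ k" using R_pos[of i] by simp
qed

(* Birkhoff's contraction, the engine of the Perron--Frobenius theorem. *)
lemma gap_contraction:
  obtains t where "0 \<le> t" "t < 1"
    "\<And>j. upper (j + k) - lower (j + k) \<le> t * (upper j - lower j)"
proof -
  obtain \<beta> where \<beta>: "0 < \<beta>" "\<beta> \<le> \<rho> ^ k" "\<And>i j. \<beta> * R$i \<le> P$i$j"
    using contraction_constant by blast
  define t where "t = 1 - \<beta> / \<rho> ^ k"
  let ?gap = "\<lambda>x. max_ratio R x - min_ratio R x"
  have "upper (j + k) - lower (j + k) \<le> t * (upper j - lower j)" for j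
  proof -
    have "upper (j + k) - lower (j + k) = ?gap (P *v orbit j) / \<rho> ^ (j + k)"
      by (simp add: lower_def upper_def orbit_add_power diff_divide_distrib)
    also have "\<dots> \<le> (\<rho> ^ k - \<beta>) * ?gap (orbit j) / \<rho> ^ (j + k)"
      using ratio_gap_mult_contract[OF R_pos R_sum power_eigen \<beta>(3)] eigenvalue_pos
      by (intro divide_right_mono) simp_all
    also have "\<dots> = t * (upper j - lower j)"
      using eigenvalue_pos by (simp add: t_def lower_def upper_def power_add field_simps)
    finally show ?thesis .
  qed
  moreover have "0 \<le> t" "t < 1" using \<beta> eigenvalue_pos by (simp_all add: t_def)
  ultimately show ?thesis using that by blast
qed

lemma gap_tendsto_0: "(\<lambda>j. upper j - lower j) \<longlonglongrightarrow> 0"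
proof -
  obtain t where t: "0 \<le> t" "t < 1" and g_step: "\<And>j. upper (j + k) - lower (j + k) \<le> t * (upper j - lower j)"
    using gap_contraction by blast
  define g where "g j = upper j - lower j" for j
  have g_nonneg: "0 \<le> g j" for j using lower_le_upper[of j] by (simp add: g_def)
  have g_power: "g (i * k) \<le> t ^ i * g 0" for i
  proof (induction i)
    case (Suc i)
    have "g (Suc i * k) \<le> t * g (i * k)" using g_step[of "i * k"] by (simp add: g_def add.commute)
    also have "\<dots> \<le> t * (t ^ i * g 0)" using Suc t by (simp add: mult_left_mono)
    finally show ?case by simp
  qed simp
  have "decseq g"
    using incseq_lower decseq_upper by (simp add: g_def decseq_def incseq_def diff_mono)
  then obtain L where L: "g \<longlonglongrightarrow> L" "\<And>j. L \<le> g j"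
    using decseq_convergent[of g 0] g_nonneg by blast
  have "(\<lambda>i. t ^ i * g 0) \<longlonglongrightarrow> 0"
    using t by (intro tendsto_mult_left_zero LIMSEQ_power_zero) simp
  moreover have "L \<le> t ^ i * g 0" for i
    using L(2)[of "i * k"] g_power[of i] by linarith
  ultimately have "L \<le> 0"
    by (intro LIMSEQ_le_const) auto
  moreover have "0 \<le> L"
    using L(1) g_nonneg by (intro LIMSEQ_le_const) auto
  ultimately show ?thesis using L(1) by (simp add: g_def[abs_def])
qed

lemma lower_upper_tendsto:
  obtains c where "0 < c" "lower \<longlonglongrightarrow> c" "upper \<longlonglongrightarrow> c"
proof -
  have "lower j \<le> upper 0" for j
    using lower_le_upper[of j] decseqD[OF decseq_upper, of 0 j] by simp
  then obtain c where lower_lim: "lower \<longlonglongrightarrow> c" and lower_le: "\<And>j. lower j \<le> c"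
    using incseq_convergent[OF incseq_lower, of "upper 0"] by blast
  have "(\<lambda>j. lower j + (upper j - lower j)) \<longlonglongrightarrow> c + 0"
    by (intro tendsto_add lower_lim gap_tendsto_0)
  then have upper_lim: "upper \<longlonglongrightarrow> c" by simp
  have "orbit k = P *v x\<^sub>0" using orbit_add_power[of 0] by simp
  then have "0 < lower k"
    using min_ratio_pos[OF R_pos] start_pos eigenvalue_pos by (simp add: lower_def)
  then have "0 < c" using lower_le[of k] by simp
  then show ?thesis using lower_lim upper_lim by (rule that)
qed

lemma mass_tendsto_at_top: "filterlim (\<lambda>p. \<Sum>i\<in>UNIV. orbit p $ i) at_top sequentially"
proof (rule filterlim_at_top_mono)
  obtain c where "0 < c" "lower \<longlonglongrightarrow> c" using lower_upper_tendsto by blast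
  moreover have "filterlim (\<lambda>p. \<rho> ^ p) at_top sequentially"
    using filterlim_at_infinity_imp_norm_at_top[OF filterlim_realpow_sequentially_gt1[of \<rho>]]
      eigenvalue_gt_1 by simp
  ultimately show "filterlim (\<lambda>p. lower p * \<rho> ^ p) at_top sequentially"
    by (intro filterlim_tendsto_pos_mult_at_top)
  show "\<forall>\<^sub>F p in sequentially. lower p * \<rho> ^ p \<le> (\<Sum>i\<in>UNIV. orbit p $ i)"
    using min_ratio_le_sum[OF R_pos R_sum] eigenvalue_pos by (simp add: lower_def)
qed

lemma weighted_upper_sum_ratio_tendsto:
  "(\<lambda>p. (\<Sum>j<p. upper j * \<rho> ^ j) / (lower p * \<rho> ^ p)) \<longlonglongrightarrow> 1 / (\<rho> - 1)"
proof -
  obtain c where c: "0 < c" "lower \<longlonglongrightarrow> c" "upper \<longlonglongrightarrow> c" using lower_upper_tendsto by blast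
  define S where "S p = (\<Sum>j<p. upper j * (1 / \<rho>) ^ (p - j))" for p
  have "S \<longlonglongrightarrow> c * ((1 / \<rho>) / (1 - 1 / \<rho>))"
    unfolding S_def using c(3) eigenvalue_gt_1 by (intro tendsto_sum_mult_power_diff) auto
  then have "(\<lambda>p. S p / lower p) \<longlonglongrightarrow> c * ((1 / \<rho>) / (1 - 1 / \<rho>)) / c"
    using c by (intro tendsto_divide) simp_all
  moreover have "c * ((1 / \<rho>) / (1 - 1 / \<rho>)) / c = 1 / (\<rho> - 1)"
    using c eigenvalue_gt_1 by (simp add: field_simps)
  moreover have "(\<Sum>j<p. upper j * \<rho> ^ j) / (lower p * \<rho> ^ p) = S p / lower p" for p
  proof -
    have "(1 / \<rho>) ^ (p - j) * \<rho> ^ p = \<rho> ^ j" if "j < p" for j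
    proof -
      have "\<rho> ^ p = \<rho> ^ (p - j) * \<rho> ^ j" using that by (simp flip: power_add)
      then show ?thesis using eigenvalue_pos by (simp add: power_one_over)
    qed
    then have "(\<Sum>j<p. upper j * \<rho> ^ j) = S p * \<rho> ^ p"
      unfolding S_def sum_distrib_right by (intro sum.cong) (simp_all add: mult.assoc)
    then show ?thesis using eigenvalue_pos by simp
  qed
  ultimately show ?thesis by simp
qed

lemma eventually_weighted_orbit_sum_le:
  assumes q_nonneg: "\<And>i. q$i \<ge> 0" and \<eta>: "\<eta> > 0"
  shows "\<forall>\<^sub>F p in sequentially.
    (\<Sum>j<p. q \<bullet> orbit j) \<le> (q \<bullet> R / (\<rho> - 1) + \<eta>) * (\<Sum>i\<in>UNIV. orbit p $ i)"
proof -
  obtain c where c: "0 < c" "lower \<longlonglongrightarrow> c" using lower_upper_tendsto by blast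
  define ratio where "ratio p = (\<Sum>j<p. upper j * \<rho> ^ j) / (lower p * \<rho> ^ p)" for p
  define bound where "bound = 1 / (\<rho> - 1) + \<eta> / (q \<bullet> R + 1)"
  have qR: "0 \<le> q \<bullet> R"
    unfolding inner_vec_def inner_real_def by (intro sum_nonneg mult_nonneg_nonneg q_nonneg R_nonneg)
  have "1 / (\<rho> - 1) < bound" using \<eta> qR by (simp add: bound_def add_nonneg_pos)
  with weighted_upper_sum_ratio_tendsto have "\<forall>\<^sub>F p in sequentially. ratio p < bound"
    unfolding ratio_def by (rule order_tendstoD(2))
  moreover have "\<forall>\<^sub>F p in sequentially. 0 < lower p"
    using c by (intro order_tendstoD(1))
  ultimately show ?thesis
  proof eventually_elim
    case (elim p)
    have mass_ge: "lower p * \<rho> ^ p \<le> (\<Sum>i\<in>UNIV. orbit p $ i)"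
      using min_ratio_le_sum[OF R_pos R_sum, of "orbit p"] eigenvalue_pos by (simp add: lower_def)
    have "(\<Sum>j<p. q \<bullet> orbit j) \<le> q \<bullet> R * (\<Sum>j<p. upper j * \<rho> ^ j)"
      unfolding sum_distrib_left using inner_le_max_ratio[OF R_pos q_nonneg] eigenvalue_pos
      by (intro sum_mono) (simp add: upper_def mult_ac)
    also have "\<dots> = q \<bullet> R * (ratio p * (lower p * \<rho> ^ p))"
      using elim(2) eigenvalue_pos by (simp add: ratio_def)
    also have "\<dots> \<le> q \<bullet> R * (bound * (\<Sum>i\<in>UNIV. orbit p $ i))"
      using elim mass_ge qR eigenvalue_pos \<eta> eigenvalue_gt_1
      by (intro mult_left_mono mult_mono) (simp_all add: bound_def)
    also have "\<dots> \<le> (q \<bullet> R / (\<rho> - 1) + \<eta>) * (\<Sum>i\<in>UNIV. orbit p $ i)"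
    proof -
      have "q \<bullet> R * (\<eta> / (q \<bullet> R + 1)) \<le> \<eta>" using qR \<eta> by (simp add: field_simps)
      then have "q \<bullet> R * bound \<le> q \<bullet> R / (\<rho> - 1) + \<eta>" by (simp add: bound_def distrib_left)
      moreover have "0 \<le> (\<Sum>i\<in>UNIV. orbit p $ i)"
        using elim(2) mass_ge eigenvalue_pos by (meson order_trans less_imp_le mult_pos_pos zero_less_power)
      ultimately show ?thesis by (simp add: mult.assoc[symmetric] mult_right_mono)
    qed
    finally show ?case .
  qed
qed

end

section \<open>Semi-compatible random substitutions\<close>

locale semi_compatible_substitution =
  fixes \<theta> :: "'a::finite \<Rightarrow> 'a list set"
  assumes random: "is_random_substitution \<theta>" and semi: "semi_compatible \<theta>"
begin

abbreviation "M \<equiv> subst_matrix \<theta>"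
abbreviation "q \<equiv> log_card_vector \<theta>"

lemma finite_image: "finite (\<theta> a)" and image_nonempty: "\<theta> a \<noteq> {}"
  and image_word_nonempty: "w \<in> \<theta> a \<Longrightarrow> w \<noteq> []"
  using random by (auto simp: is_random_substitution_def)

(* subst_matrix reads the letter counts off an arbitrarily chosen word of \<theta> x;
   semi-compatibility makes the choice irrelevant. *)
lemma abelianisation_image: "w \<in> \<theta> x \<Longrightarrow> abelianisation w = M *v abelianisation [x]"
proof -
  assume w: "w \<in> \<theta> x"
  have "(SOME u. u \<in> \<theta> x) \<in> \<theta> x" using image_nonempty[of x] by (simp add: some_in_eq)
  then have "abelianisation w = abelianisation (SOME u. u \<in> \<theta> x)"
    using semi w unfolding semi_compatible_def by blast
  then show ?thesis
    unfolding matrix_vector_mult_abelianisation_singleton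
    by (simp add: vec_eq_iff subst_matrix_def abelianisation_def)
qed

lemma abelianisation_subst_word: "w \<in> subst_word \<theta> u \<Longrightarrow> abelianisation w = M *v abelianisation u"
proof (induction u arbitrary: w)
  case (Cons x u)
  then obtain w1 w2 where "w = w1 @ w2" "w1 \<in> \<theta> x" "w2 \<in> subst_word \<theta> u" by auto
  then show ?case
    using Cons.IH abelianisation_image abelianisation_append[of "[x]" u]
    by (simp add: abelianisation_append matrix_vector_right_distrib)
qed (simp add: abelianisation_Nil)

lemma abelianisation_subst_pow:
  "w \<in> subst_pow \<theta> j a \<Longrightarrow> abelianisation w = ((*v) M ^^ j) (abelianisation [a])"
proof (induction j arbitrary: w)
  case (Suc j)
  then obtain u where "u \<in> subst_pow \<theta> j a" "w \<in> subst_word \<theta> u" by (auto simp: subst_pow_Suc)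
  then show ?case using Suc.IH abelianisation_subst_word by simp
qed (simp add: subst_pow_def)

lemma length_subst_pow:
  "w \<in> subst_pow \<theta> j a \<Longrightarrow> real (length w) = (\<Sum>i\<in>UNIV. ((*v) M ^^ j) (abelianisation [a]) $ i)"
  using length_eq_sum_abelianisation[of w] abelianisation_subst_pow by simp

lemma card_image_eq_exp: "real (card (\<theta> x)) = exp (q $ x)"
  using finite_image[of x] image_nonempty[of x] by (simp add: log_card_vector_def card_gt_0_iff)

lemma log_card_nonneg: "0 \<le> q $ x"
  using finite_image[of x] image_nonempty[of x]
  by (simp add: log_card_vector_def Suc_le_eq card_gt_0_iff)

lemma card_subst_pow_le:
  "real (card (subst_pow \<theta> j a)) \<le> exp (\<Sum>i<j. q \<bullet> ((*v) M ^^ i) (abelianisation [a]))"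
proof (induction j)
  case (Suc j)
  let ?x = "((*v) M ^^ j) (abelianisation [a])"
  have "card (subst_pow \<theta> (Suc j) a) \<le> (\<Sum>u\<in>subst_pow \<theta> j a. card (subst_word \<theta> u))"
    unfolding subst_pow_Suc by (rule card_UN_le[OF finite_subst_pow[OF finite_image]])
  then have "real (card (subst_pow \<theta> (Suc j) a)) \<le> (\<Sum>u\<in>subst_pow \<theta> j a. real (card (subst_word \<theta> u)))"
    by (metis of_nat_le_iff of_nat_sum)
  also have "\<dots> \<le> (\<Sum>u\<in>subst_pow \<theta> j a. exp (q \<bullet> ?x))"
  proof (rule sum_mono)
    fix u assume u: "u \<in> subst_pow \<theta> j a"
    have "real (card (subst_word \<theta> u)) \<le> exp (sum_list (map (($) q) u))"
      using finite_image card_image_eq_exp by (intro card_subst_word_le_exp) auto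
    also have "sum_list (map (($) q) u) = q \<bullet> ?x"
      using abelianisation_subst_pow[OF u] by (simp flip: inner_abelianisation)
    finally show "real (card (subst_word \<theta> u)) \<le> exp (q \<bullet> ?x)" .
  qed
  also have "\<dots> = real (card (subst_pow \<theta> j a)) * exp (q \<bullet> ?x)" by simp
  also have "\<dots> \<le> exp (\<Sum>i<j. q \<bullet> ((*v) M ^^ i) (abelianisation [a])) * exp (q \<bullet> ?x)"
    using Suc by (simp add: mult_right_mono)
  finally show ?case by (simp add: exp_add)
qed (simp add: subst_pow_def)

lemma column_sum_eq_length: "w \<in> \<theta> x \<Longrightarrow> (\<Sum>i\<in>UNIV. M $ i $ x) = real (length w)"
  using length_eq_sum_abelianisation[of w] abelianisation_image[of w x]
  by (simp add: matrix_vector_mult_abelianisation_singleton)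

lemma column_sum_ge_1: "1 \<le> (\<Sum>i\<in>UNIV. M $ i $ x)"
proof -
  obtain w where w: "w \<in> \<theta> x" using image_nonempty by blast
  then have "w \<noteq> []" by (rule image_word_nonempty)
  then show ?thesis using column_sum_eq_length[OF w] by (simp add: Suc_le_eq)
qed

lemma eigenvalue_gt_1_or_column_sums_1:
  assumes eigen: "M *v R = \<rho> *s R" and R_pos: "\<And>i. 0 < R $ i" and R_sum: "(\<Sum>i\<in>UNIV. R $ i) = 1"
  shows "1 < \<rho> \<or> \<rho> = 1 \<and> (\<forall>x. (\<Sum>i\<in>UNIV. M $ i $ x) = 1)"
proof -
  define d where "d x = ((\<Sum>i\<in>UNIV. M $ i $ x) - 1) * R $ x" for x
  have "\<rho> = (\<Sum>i\<in>UNIV. (M *v R) $ i)" using eigen R_sum by (simp flip: sum_distrib_left)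
  also have "\<dots> = (\<Sum>x\<in>UNIV. (\<Sum>i\<in>UNIV. M $ i $ x) * R $ x)" by (rule sum_matrix_vector_mult)
  finally have \<rho>_eq: "\<rho> - 1 = sum d UNIV"
    using R_sum by (simp add: d_def sum_subtractf left_diff_distrib)
  have d_nonneg: "0 \<le> d x" for x
    using column_sum_ge_1[of x] R_pos[of x] by (simp add: d_def)
  consider "1 < \<rho>" | "sum d UNIV = 0"
    using \<rho>_eq sum_nonneg[of UNIV d] d_nonneg by fastforce
  then show ?thesis
  proof cases
    case 2
    then have "d x = 0" for x using sum_nonneg_eq_0_iff[of UNIV d] d_nonneg by simp
    then show ?thesis using R_pos \<rho>_eq 2 by (simp add: d_def) (metis less_irrefl)
  qed simp
qed

lemma entropy_eq_0_if_column_sums_1: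
  assumes column_sums: "\<And>x. (\<Sum>i\<in>UNIV. M $ i $ x) = 1"
    and entropy: "has_topological_entropy \<theta> s"
  shows "s = 0"
proof -
  have mass: "(\<Sum>i\<in>UNIV. ((*v) M ^^ j) (abelianisation [a]) $ i) = 1" for j a
  proof (induction j)
    case 0
    show ?case using length_eq_sum_abelianisation[of "[a]"] by simp
  next
    case (Suc j)
    then show ?case by (simp add: sum_matrix_vector_mult column_sums)
  qed
  have empty: "language_len \<theta> l = {}" if "2 \<le> l" for l
  proof -
    have "length w = 1" if "w \<in> subst_pow \<theta> j a" for w j a
      using length_subst_pow[OF that] mass by simp
    then show ?thesis
      using \<open>2 \<le> l\<close> unfolding language_len_def language_def by fastforce
  qed
  have "\<forall>\<^sub>F l in sequentially. ln (real (card (language_len \<theta> l))) / real l = 0"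
    using eventually_ge_at_top[of "2 :: nat"] by eventually_elim (simp add: empty)
  then have "(\<lambda>l. ln (real (card (language_len \<theta> l))) / real l) \<longlonglongrightarrow> 0"
    by (rule tendsto_eventually)
  then show ?thesis
    using entropy LIMSEQ_unique by (auto simp: has_topological_entropy_def)
qed

lemma entropy_le_of_power_bound:
  assumes entropy: "has_topological_entropy \<theta> s" and C: "0 \<le> C" and B: "1 \<le> B"
    and sum_le: "\<And>a. (\<Sum>j<p. q \<bullet> ((*v) M ^^ j) (abelianisation [a]))
      \<le> C * (\<Sum>i\<in>UNIV. ((*v) M ^^ p) (abelianisation [a]) $ i)"
    and mass_ge: "\<And>a. B \<le> (\<Sum>i\<in>UNIV. ((*v) M ^^ p) (abelianisation [a]) $ i)"
  shows "s \<le> C + (1 + ln CARD('a)) / B"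
proof -
  define \<tau> where "\<tau> = subst_pow \<theta> p"
  define L where "L a = length (SOME w. w \<in> \<tau> a)" for a
  define m where "m = Min (range L)"
  have L_eq: "real (L a) = (\<Sum>i\<in>UNIV. ((*v) M ^^ p) (abelianisation [a]) $ i)" for a
  proof -
    have "(SOME w. w \<in> \<tau> a) \<in> \<tau> a"
      using subst_pow_nonempty[OF image_nonempty] by (simp add: \<tau>_def some_in_eq)
    then show ?thesis unfolding L_def \<tau>_def by (rule length_subst_pow)
  qed
  have len: "length w = L a" if "w \<in> \<tau> a" for w a
    using length_subst_pow[of w p a] that L_eq[of a] unfolding \<tau>_def by simp
  have card: "real (card (\<tau> a)) \<le> exp (C * real (L a))" for a
  proof -
    have "(\<Sum>j<p. q \<bullet> ((*v) M ^^ j) (abelianisation [a])) \<le> C * real (L a)"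
      using sum_le[of a] L_eq[of a] by simp
    then show ?thesis unfolding \<tau>_def by (intro order_trans[OF card_subst_pow_le]) simp
  qed
  have m_le: "m \<le> L a" for a by (simp add: m_def)
  have "m \<in> range L" unfolding m_def by (rule Min_in) auto
  then have m_ge: "B \<le> real m" using L_eq mass_ge by auto
  have "s \<le> C + (1 + ln CARD('a)) / m"
    using B m_ge unfolding \<tau>_def
    by (intro entropy_le_of_covering_substitution[OF _ len[unfolded \<tau>_def] m_le _ C card[unfolded \<tau>_def]
        eventually_language_factor_of_subst_pow entropy] finite_subst_pow finite_image) simp_all
  also have "(1 + ln CARD('a)) / m \<le> (1 + ln CARD('a)) / B"
    using B m_ge by (intro divide_left_mono) (simp_all add: add_nonneg_nonneg)
  finally show ?thesis by simp
qed

lemma entropy_le_of_eigenvalue_gt_1: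
  assumes "\<And>i j. 0 \<le> M $ i $ j" and "M *v R = \<rho> *s R"
    and R_nonneg: "\<And>i. 0 \<le> R $ i" and "(\<Sum>i\<in>UNIV. R $ i) = 1"
    and "\<And>i j. 0 < mat_pow M k $ i $ j" and \<rho>: "1 < \<rho>"
    and entropy: "has_topological_entropy \<theta> s"
  shows "s \<le> q \<bullet> R / (\<rho> - 1)"
proof (rule field_le_epsilon)
  fix \<epsilon> :: real assume \<epsilon>: "0 < \<epsilon>"
  define B where "B = max 1 (2 * (1 + ln CARD('a)) / \<epsilon>)"
  have orbit: "primitive_orbit M R \<rho> k (abelianisation [a])" for a
    using assms by unfold_locales (simp_all add: matrix_vector_mult_abelianisation_singleton)
  have "\<forall>\<^sub>F p in sequentially. \<forall>a.
      (\<Sum>j<p. q \<bullet> ((*v) M ^^ j) (abelianisation [a]))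
        \<le> (q \<bullet> R / (\<rho> - 1) + \<epsilon> / 2) * (\<Sum>i\<in>UNIV. ((*v) M ^^ p) (abelianisation [a]) $ i)
      \<and> B \<le> (\<Sum>i\<in>UNIV. ((*v) M ^^ p) (abelianisation [a]) $ i)"
    using primitive_orbit.eventually_weighted_orbit_sum_le[OF orbit log_card_nonneg, of "\<epsilon> / 2"]
      primitive_orbit.mass_tendsto_at_top[OF orbit, THEN filterlim_at_top[THEN iffD1], rule_format, of B]
      \<epsilon> by (intro eventually_all_finite allI eventually_conj) simp_all
  then obtain p where sum_le: "\<And>a. (\<Sum>j<p. q \<bullet> ((*v) M ^^ j) (abelianisation [a]))
        \<le> (q \<bullet> R / (\<rho> - 1) + \<epsilon> / 2) * (\<Sum>i\<in>UNIV. ((*v) M ^^ p) (abelianisation [a]) $ i)"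
    and mass_ge: "\<And>a. B \<le> (\<Sum>i\<in>UNIV. ((*v) M ^^ p) (abelianisation [a]) $ i)"
    by (auto simp: eventually_sequentially)
  have qR: "0 \<le> q \<bullet> R"
    unfolding inner_vec_def inner_real_def by (intro sum_nonneg mult_nonneg_nonneg log_card_nonneg R_nonneg)
  have "s \<le> (q \<bullet> R / (\<rho> - 1) + \<epsilon> / 2) + (1 + ln CARD('a)) / B"
    using qR \<rho> \<epsilon> by (intro entropy_le_of_power_bound[OF entropy _ _ sum_le mass_ge]) (simp_all add: B_def)
  also have "(1 + ln CARD('a)) / B \<le> \<epsilon> / 2"
  proof -
    have "2 * (1 + ln CARD('a)) / \<epsilon> \<le> B" and "0 < B" by (simp_all add: B_def)
    then show ?thesis using \<epsilon> by (simp add: pos_divide_le_eq mult.commute)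
  qed
  finally show "s \<le> q \<bullet> R / (\<rho> - 1) + \<epsilon>" by simp
qed

end

theorem mainTheorem7:
  fixes \<theta> :: "'a::finite \<Rightarrow> 'a list set" and R :: "real ^ 'a" and s :: real
  assumes "is_random_substitution \<theta>"
    and "semi_compatible \<theta>"
    and "primitive_matrix (subst_matrix \<theta>)"
    and "is_right_pf_vector (subst_matrix \<theta>) R"
    and "has_topological_entropy \<theta> s"
  shows "s \<le> (log_card_vector \<theta> \<bullet> R) / (pf_eigenvalue (subst_matrix \<theta>) - 1)"
proof -
  interpret semi_compatible_substitution \<theta> using assms(1,2) by unfold_locales
  define \<rho> where "\<rho> = pf_eigenvalue M"
  obtain k where power_pos: "\<And>i j. 0 < mat_pow M k $ i $ j" and M_nonneg: "\<And>i j. 0 \<le> M $ i $ j"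
    using assms(3) by (auto simp: primitive_matrix_def)
  have eigen: "M *v R = \<rho> *s R" and R_nonneg: "\<And>i. 0 \<le> R $ i" and R_sum: "(\<Sum>i\<in>UNIV. R $ i) = 1"
    using assms(4) by (auto simp: is_right_pf_vector_def \<rho>_def)
  have "R \<noteq> 0" using R_sum by auto
  then have R_pos: "0 < R $ i" for i
    by (rule eigenvector_pos_of_pos_matrix[OF power_pos mat_pow_eigen[OF eigen] R_nonneg])
  from eigenvalue_gt_1_or_column_sums_1[OF eigen R_pos R_sum] show ?thesis
  proof
    assume "1 < \<rho>"
    then show ?thesis
      using entropy_le_of_eigenvalue_gt_1[OF M_nonneg eigen R_nonneg R_sum power_pos _ assms(5)]
      by (simp add: \<rho>_def)
  next
    assume "\<rho> = 1 \<and> (\<forall>x. (\<Sum>i\<in>UNIV. M $ i $ x) = 1)"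
    moreover from this have "s = 0" using entropy_eq_0_if_column_sums_1 assms(5) by blast
    (* the bound reads s \<le> q \<bullet> R / 0, and division by zero is 0 *)
    ultimately show ?thesis by (simp add: \<rho>_def)
  qed
qed

end
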